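(* Let $q$ be a complex number with $0<|q|<1$. For any complex numbers $a$ and $b$ not of the form $-q^{-m}$ with $m\ge 0$ an integer, it holds that $${}_2\phi_1\!\left[\begin{matrix}a,\;a/q\\ a^2\end{matrix};q^2,q^2\right]\;{}_2\phi_1\!\left[\begin{matrix}b,\;b/q\\ b^2\end{matrix};q^2,q^2\right]=\frac{(q;q^2)_\infty}{(q^2;q^2)_\infty}\;{}_4\phi_3\!\left[\begin{matrix}(ab)^{1/2},\,-(ab)^{1/2},\,(ab/q)^{1/2},\,-(ab/q)^{1/2}\\ -a,\;-b,\;ab/q\end{matrix};q,q\right].$$
   Context: For $|p|<1$: $(x;p)_\infty=\prod_{i=0}^\infty(1-xp^i)$ and, for integers $n\ge 0$, $(x;p)_n=\prod_{i=0}^{n-1}(1-xp^i)$ (empty product equal to $1$). The basic hypergeometric series with base $p$ and argument $x$ is ${}_{r+1}\phi_r\!\left[\begin{matrix}a_1,\dots,a_{r+1}\\ b_1,\dots,b_r\end{matrix};p,x\right]=\sum_{n=0}^\infty\frac{(a_1;p)_n\cdots(a_{r+1};p)_n}{(p;p)_n(b_1;p)_n\cdots(b_r;p)_n}x^n$. Here $(ab)^{1/2}$ and $(ab/q)^{1/2}$ denote square roots; the choice is immaterial because each appears with both signs. *)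

theory Defs
  imports "HOL-Analysis.Analysis"
begin

definition q_poch :: "complex \<Rightarrow> complex \<Rightarrow> nat \<Rightarrow> complex" where
  "q_poch x p n = (\<Prod>i<n. 1 - x * p ^ i)"

definition q_poch_inf :: "complex \<Rightarrow> complex \<Rightarrow> complex" where
  "q_poch_inf x p = (\<Prod>i. 1 - x * p ^ i)"

definition bhs_term ::
  "complex list \<Rightarrow> complex list \<Rightarrow> complex \<Rightarrow> complex \<Rightarrow> nat \<Rightarrow> complex" where
  "bhs_term as bs p x n =
     (\<Prod>a\<leftarrow>as. q_poch a p n) / (q_poch p p n * (\<Prod>b\<leftarrow>bs. q_poch b p n)) * x ^ n"

text \<open>
  The series with \<open>r + 1\<close> upper parameters \<open>as\<close> and \<open>r\<close> lower parameters \<open>bs\<close>, base \<open>p\<close>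
  and argument \<open>x\<close>. It has its usual meaning only if no denominator vanishes, that is, if
  \<open>bhs_regular bs p\<close> holds (and \<open>p\<close> is not a root of unity).
\<close>

definition bhs :: "complex list \<Rightarrow> complex list \<Rightarrow> complex \<Rightarrow> complex \<Rightarrow> complex" where
  "bhs as bs p x = (\<Sum>n. bhs_term as bs p x n)"

definition bhs_regular :: "complex list \<Rightarrow> complex \<Rightarrow> bool" where
  "bhs_regular bs p \<longleftrightarrow> (\<forall>b\<in>set bs. \<forall>n. q_poch b p n \<noteq> 0)"

text \<open>
  If the upper and lower parameters are functions \<open>A\<close>, \<open>B\<close> of a variable \<open>c\<close>, then a zero of
  a denominator may be cancelled by a zero of the numerator. For example,
  \<open>(a;q\<^sup>2)\<^sub>n (a/q;q\<^sup>2)\<^sub>n / (a\<^sup>2;q\<^sup>2)\<^sub>n\<close> is of the form \<open>0 / 0\<close> at \<open>a = q\<^bsup>-m\<^esup>\<close> if \<open>n > m\<close>, but for \<open>n \<ge> 1\<close>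
  it equals \<open>(1 - a/q) (a q\<^sup>n;q)\<^bsub>n-1\<^esub> / (-a;q)\<^sub>n\<close> at all regular \<open>a\<close>. The following is the series
  whose terms are extended over such removable singularities, the limit being taken through
  regular values of the variable. Evaluating \<open>0 / 0\<close> as \<open>0\<close> instead would truncate the series.
\<close>

definition bhs_ext ::
  "('c::t2_space \<Rightarrow> complex list) \<Rightarrow> ('c \<Rightarrow> complex list) \<Rightarrow> complex \<Rightarrow> complex \<Rightarrow> 'c \<Rightarrow> complex" where
  "bhs_ext A B p x c =
     (\<Sum>n. Lim (at c within {c'. bhs_regular (B c') p}) (\<lambda>c'. bhs_term (A c') (B c') p x n))"

end

theory Submission
  imports Defs
begin

text \<open>
  Clear the \<open>(-a;q)\<^sub>n\<close> and \<open>(-b;q)\<^sub>n\<close> from the denominators of the right-hand series, which gives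
  \<open>R a b = (\<Sum>n. q\<^sup>n (a b q\<^bsup>n-1\<^esup>;q)\<^sub>n (-a q\<^sup>n;q)\<^sub>\<infinity> (-b q\<^sup>n;q)\<^sub>\<infinity> / (q;q)\<^sub>n)\<close>. A contiguous relation between the
  summands at \<open>a\<close>, \<open>a q\<close> and \<open>a q\<^sup>2\<close> shows that \<open>R a b - a R (a q) b\<close> is invariant under \<open>a \<mapsto> a q\<close>,
  hence equal to \<open>R 0 b\<close>. This recurrence determines \<open>R\<close>, so that \<open>R a b = (q;q)\<^sub>\<infinity> R a 0 R b 0\<close>, where
  \<open>R a 0\<close> is, up to the factor \<open>(q;q)\<^sub>\<infinity>\<close>, the partial theta function \<open>\<Sum>n. a\<^sup>n q\<^bsup>n(n-1)/2\<^esup>\<close>.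
  Termwise, \<open>(-a;q)\<^sub>\<infinity> (-q;q)\<^sub>\<infinity>\<close> times the \<open>\<^sub>2\<phi>\<^sub>1\<close> series is \<open>R a 1 - R a q\<close>, which the product formula and
  the recurrence at \<open>a = 1\<close> reduce to \<open>R a 0\<close>.
\<close>

section \<open>Finite q-Pochhammer symbols: splitting and doubling\<close>

lemma q_poch_0 [simp]: "q_poch x p 0 = 1"
  by (simp add: q_poch_def)

lemma q_poch_Suc: "q_poch x p (Suc n) = q_poch x p n * (1 - x * p ^ n)"
  by (simp add: q_poch_def)

lemma q_poch_Suc': "q_poch x p (Suc n) = (1 - x) * q_poch (x * p) p n"
  unfolding q_poch_def prod.lessThan_Suc_shift by (simp add: mult_ac)

lemma q_poch_zero [simp]: "q_poch 0 p n = 1"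
  by (simp add: q_poch_def)

lemma q_poch_add: "q_poch x p (m + n) = q_poch x p m * q_poch (x * p ^ m) p n"
  by (induction n) (simp_all add: q_poch_Suc power_add mult_ac)

lemma q_poch_mult_minus: "q_poch x p n * q_poch (- x) p n = q_poch (x\<^sup>2) (p\<^sup>2) n"
proof -
  have "(1 - x * p ^ i) * (1 - - x * p ^ i) = 1 - x\<^sup>2 * (p\<^sup>2) ^ i" for i
    by (simp add: algebra_simps power2_eq_square power_mult_distrib)
  thus ?thesis
    unfolding q_poch_def prod.distrib [symmetric] by (intro prod.cong refl)
qed

text \<open>Even and odd exponents of \<open>p\<close> are collected separately.\<close>

lemma q_poch_double: "q_poch x p (2 * n) = q_poch x (p\<^sup>2) n * q_poch (x * p) (p\<^sup>2) n"
  by (induction n)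
    (simp_all add: q_poch_Suc power_mult [symmetric] mult_ac)

lemma q_poch_eq_0_iff: "q_poch x p n = 0 \<longleftrightarrow> (\<exists>i<n. x * p ^ i = 1)"
  by (auto simp: q_poch_def)

lemma tendsto_q_poch [tendsto_intros]:
  "(f \<longlongrightarrow> x) F \<Longrightarrow> ((\<lambda>z. q_poch (f z) p n) \<longlongrightarrow> q_poch x p n) F"
  unfolding q_poch_def by (intro tendsto_intros)

section \<open>Infinite q-Pochhammer symbols as limits of finite ones\<close>

lemma convergent_prod_q_poch:
  fixes x p :: complex
  assumes "norm p < 1"
  shows "convergent_prod (\<lambda>i. 1 - x * p ^ i)"
proof -
  have "summable (\<lambda>i. norm x * norm p ^ i)"
    using assms by (intro summable_mult summable_geometric) simp
  hence "summable (\<lambda>i. norm ((1 - x * p ^ i) - 1))"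
    by (simp add: norm_mult norm_power)
  thus ?thesis
    by (intro abs_convergent_prod_imp_convergent_prod summable_imp_abs_convergent_prod)
qed

lemma q_poch_LIMSEQ:
  assumes "norm p < 1"
  shows "(\<lambda>n. q_poch x p n) \<longlonglongrightarrow> q_poch_inf x p"
proof -
  \<comment> \<open>\<open>convergent_prod_LIMSEQ\<close> speaks of products over
    \<open>{..n}\<close>, which have \<open>Suc n\<close> factors.\<close>
  have "(\<lambda>n. q_poch x p (Suc n)) \<longlonglongrightarrow> q_poch_inf x p"
    using convergent_prod_LIMSEQ [OF convergent_prod_q_poch [OF assms]]
    by (simp add: q_poch_def q_poch_inf_def lessThan_Suc_atMost)
  thus ?thesis
    by (simp only: filterlim_sequentially_Suc)
qed

lemma q_poch_inf_nonzero:
  assumes "norm p < 1" "\<And>n. q_poch x p n \<noteq> 0"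
  shows "q_poch_inf x p \<noteq> 0"
  unfolding q_poch_inf_def
proof (rule prodinf_nonzero [OF convergent_prod_q_poch [OF assms(1)]])
  show "1 - x * p ^ i \<noteq> 0" for i
    using assms(2) [of "Suc i"] by (simp add: q_poch_Suc)
qed

lemma q_poch_inf_split:
  assumes "norm p < 1"
  shows "q_poch_inf x p = q_poch x p n * q_poch_inf (x * p ^ n) p"
proof (rule LIMSEQ_unique)
  show "(\<lambda>k. q_poch x p (n + k)) \<longlonglongrightarrow> q_poch x p n * q_poch_inf (x * p ^ n) p"
    unfolding q_poch_add by (intro tendsto_intros q_poch_LIMSEQ assms)
  show "(\<lambda>k. q_poch x p (n + k)) \<longlonglongrightarrow> q_poch_inf x p"
    using LIMSEQ_ignore_initial_segment [OF q_poch_LIMSEQ [OF assms], of x n]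
    by (simp add: add.commute)
qed

lemma q_poch_inf_step:
  "norm p < 1 \<Longrightarrow> q_poch_inf x p = (1 - x) * q_poch_inf (x * p) p"
  using q_poch_inf_split [of p x 1] by (simp add: q_poch_Suc)

lemma q_poch_inf_mult_minus:
  assumes "norm p < 1"
  shows "q_poch_inf x p * q_poch_inf (- x) p = q_poch_inf (x\<^sup>2) (p\<^sup>2)"
proof (rule LIMSEQ_unique)
  have "norm (p\<^sup>2) < 1"
    using assms by (simp add: norm_power power_less_one_iff)
  thus "(\<lambda>n. q_poch (x\<^sup>2) (p\<^sup>2) n) \<longlonglongrightarrow> q_poch_inf (x\<^sup>2) (p\<^sup>2)"
    by (rule q_poch_LIMSEQ)
  show "(\<lambda>n. q_poch (x\<^sup>2) (p\<^sup>2) n) \<longlonglongrightarrow> q_poch_inf x p * q_poch_inf (- x) p"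
    unfolding q_poch_mult_minus [symmetric] by (intro tendsto_intros q_poch_LIMSEQ assms)
qed

lemma q_poch_inf_double:
  assumes "norm p < 1"
  shows "q_poch_inf x p = q_poch_inf x (p\<^sup>2) * q_poch_inf (x * p) (p\<^sup>2)"
proof (rule LIMSEQ_unique)
  have "norm (p\<^sup>2) < 1"
    using assms by (simp add: norm_power power_less_one_iff)
  thus "(\<lambda>n. q_poch x p (2 * n)) \<longlonglongrightarrow> q_poch_inf x (p\<^sup>2) * q_poch_inf (x * p) (p\<^sup>2)"
    unfolding q_poch_double by (intro tendsto_intros q_poch_LIMSEQ)
  have "strict_mono (\<lambda>n::nat. 2 * n)"
    by (simp add: strict_mono_def)
  from LIMSEQ_subseq_LIMSEQ [OF q_poch_LIMSEQ [OF assms] this]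
  show "(\<lambda>n. q_poch x p (2 * n)) \<longlonglongrightarrow> q_poch_inf x p"
    by (simp add: o_def)
qed

section \<open>Exponential bounds and the limit at argument 0\<close>

text \<open>Replacing each factor by 1 plus a norm, then using 1 + t \<le> exp t and the geometric
  series, gives a bound that is uniform in \<open>n\<close> and vanishes at \<open>x = 0\<close>.
  The first property yields dominated convergence, the second the limit at 0.\<close>

lemma norm_q_poch_minus_1_le:
  assumes "norm p < 1"
  shows "norm (q_poch x p n - 1) \<le> exp (norm x / (1 - norm p)) - 1"
proof -
  have "norm (q_poch x p n - 1) \<le> (\<Prod>i<n. 1 + norm x * norm p ^ i) - 1"
    using norm_prod_minus1_le_prod_minus1 [of "\<lambda>i. - (x * p ^ i)" "{..<n}"]
    by (simp add: q_poch_def norm_mult norm_power)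
  also have "(\<Prod>i<n. 1 + norm x * norm p ^ i) \<le> (\<Prod>i<n. exp (norm x * norm p ^ i))"
    by (intro prod_mono conjI exp_ge_add_one_self) simp
  also have "\<dots> = exp (norm x * (\<Sum>i<n. norm p ^ i))"
    by (simp add: exp_sum sum_distrib_left)
  also have "(\<Sum>i<n. norm p ^ i) \<le> 1 / (1 - norm p)"
    using assms by (simp add: sum_gp_strict divide_right_mono)
  finally show ?thesis
    by (simp add: mult_left_mono)
qed

lemma norm_q_poch_inf_minus_1_le:
  assumes "norm p < 1"
  shows "norm (q_poch_inf x p - 1) \<le> exp (norm x / (1 - norm p)) - 1"
proof (rule LIMSEQ_le_const2)
  show "(\<lambda>n. norm (q_poch x p n - 1)) \<longlonglongrightarrow> norm (q_poch_inf x p - 1)"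
    by (intro tendsto_intros q_poch_LIMSEQ assms)
qed (use norm_q_poch_minus_1_le [OF assms] in blast)

lemma norm_q_poch_le:
  assumes "norm p < 1" "norm x \<le> y"
  shows "norm (q_poch x p n) \<le> exp (y / (1 - norm p))"
    and "norm (q_poch_inf x p) \<le> exp (y / (1 - norm p))"
proof -
  have le: "exp (norm x / (1 - norm p)) \<le> exp (y / (1 - norm p))"
    using assms by (simp add: divide_right_mono)
  have *: "norm z \<le> exp (y / (1 - norm p))"
    if "norm (z - 1) \<le> exp (norm x / (1 - norm p)) - 1" for z :: complex
    using that le norm_triangle_ineq2 [of z 1] by (simp only: norm_one)
  show "norm (q_poch x p n) \<le> exp (y / (1 - norm p))"
    by (rule * [OF norm_q_poch_minus_1_le [OF assms(1)]])
  show "norm (q_poch_inf x p) \<le> exp (y / (1 - norm p))"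
    by (rule * [OF norm_q_poch_inf_minus_1_le [OF assms(1)]])
qed

lemma tendsto_q_poch_inf_0:
  assumes "norm p < 1" "(f \<longlongrightarrow> 0) F"
  shows "((\<lambda>z. q_poch_inf (f z) p) \<longlongrightarrow> 1) F"
proof (rule LIM_zero_cancel, rule Lim_null_comparison)
  show "\<forall>\<^sub>F z in F. norm (q_poch_inf (f z) p - 1) \<le> exp (norm (f z) / (1 - norm p)) - 1"
    using norm_q_poch_inf_minus_1_le [OF assms(1)] by (simp add: always_eventually)
  have "((\<lambda>z. exp (norm (f z) / (1 - norm p)) - 1) \<longlongrightarrow> exp (norm (0::complex) / (1 - norm p)) - 1) F"
    using assms by (intro tendsto_intros) auto
  thus "((\<lambda>z. exp (norm (f z) / (1 - norm p)) - 1) \<longlongrightarrow> 0) F"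
    by simp
qed

section \<open>Accumulation points of cocountable sets\<close>

text \<open>Every ball is uncountable. This will make limits through regular parameters meaningful,
  since the singular ones are countable.\<close>

lemma islimpt_countable_complement:
  fixes c :: complex
  assumes "countable C"
  shows "c islimpt (- C)"
  unfolding islimpt_approachable
proof (intro allI impI)
  fix e :: real assume "e > 0"
  have "countable (insert c C)"
    using assms by simp
  hence "\<not> ball c e \<subseteq> insert c C"
    using uncountable_ball [OF \<open>e > 0\<close>] countable_subset by blast
  thus "\<exists>x'\<in>- C. x' \<noteq> c \<and> dist x' c < e"
    by (auto simp: dist_commute)
qed

section \<open>Nonvanishing for a base in the punctured unit disc\<close>

locale nome =
  fixes q :: complex
  assumes q_pos: "0 < norm q" and q_less_1: "norm q < 1"
begin

lemma q_nonzero [simp]: "q \<noteq> 0"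
  using q_pos by auto

lemma power_neq_1: "q ^ Suc n \<noteq> 1"
proof
  assume "q ^ Suc n = 1"
  hence "norm q ^ Suc n = 1"
    by (metis norm_one norm_power)
  moreover have "norm q ^ Suc n < 1"
    using q_pos q_less_1 by (rule power_Suc_less_one)
  ultimately show False
    by simp
qed

lemma power_neq_minus_1: "q ^ Suc n \<noteq> - 1"
proof
  assume "q ^ Suc n = - 1"
  hence "norm q ^ Suc n = 1"
    by (metis norm_minus_cancel norm_one norm_power)
  moreover have "norm q ^ Suc n < 1"
    using q_pos q_less_1 by (rule power_Suc_less_one)
  ultimately show False
    by simp
qed

lemma q_poch_q_nonzero: "q_poch q q n \<noteq> 0" "q_poch (- q) q n \<noteq> 0"
  using power_neq_1 power_neq_minus_1
  by (auto simp: q_poch_eq_0_iff simp flip: power_Suc) (metis minus_minus)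

lemma q_poch_inf_q_nonzero: "q_poch_inf q q \<noteq> 0" "q_poch_inf (- q) q \<noteq> 0"
  by (intro q_poch_inf_nonzero q_less_1 q_poch_q_nonzero)+

lemma q_poch_inf_step_q: "q_poch_inf x q = (1 - x) * q_poch_inf (x * q) q"
  by (rule q_poch_inf_step [OF q_less_1])

section \<open>The series \<open>R\<close>: convergence and behaviour at 0\<close>

text \<open>The factor \<open>q ^ n / q\<close> stands for q^(n-1) and avoids truncated subtraction
  in the exponent. No denominator depends on \<open>a\<close> or \<open>b\<close>, so both may take
  any value, in particular 0, 1 and \<open>q\<close>.\<close>

definition T :: "nat \<Rightarrow> complex \<Rightarrow> complex \<Rightarrow> complex" where
  "T n a b = q ^ n * q_poch (a * b * q ^ n / q) q n / q_poch q q n *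
     (q_poch_inf (- a * q ^ n) q * q_poch_inf (- b * q ^ n) q)"

definition R :: "complex \<Rightarrow> complex \<Rightarrow> complex" where
  "R a b = (\<Sum>n. T n a b)"

lemma T_commute: "T n a b = T n b a"
  by (simp add: T_def mult_ac)

lemma R_commute: "R a b = R b a"
  by (simp add: R_def T_commute)

text \<open>Apart from the geometric factor q^n, everything is bounded uniformly on the disc of
  radius \<open>r\<close>. The majorant serves both for summability and for limits under the
  sum.\<close>

lemma T_bound:
  "\<exists>M. summable M \<and> (\<forall>n a b. norm a \<le> r \<longrightarrow> norm b \<le> r \<longrightarrow> norm (T n a b) \<le> M n)"
proof -
  \<comment> \<open>The reciprocals converge because (q;q)_n has a nonzero limit; hence they are
    bounded.\<close>
  have "(\<lambda>n. inverse (q_poch q q n)) \<longlonglongrightarrow> inverse (q_poch_inf q q)"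
    by (intro tendsto_intros q_poch_LIMSEQ q_less_1 q_poch_inf_q_nonzero)
  from convergentI [OF this, THEN convergent_imp_Bseq]
  obtain C where C: "C > 0" "\<And>n. norm (inverse (q_poch q q n)) \<le> C"
    by (auto simp: Bseq_def)
  define E where "E = (\<lambda>y. exp (y / (1 - norm q)))"
  define M where "M = (\<lambda>n. norm q ^ n * (E (r * r / norm q) * C * (E r * E r)))"
  show ?thesis
  proof (intro exI conjI allI impI)
    show "summable M"
      unfolding M_def using q_less_1 by (intro summable_mult2 summable_geometric) simp
    fix n a b assume ab: "norm (a::complex) \<le> r" "norm (b::complex) \<le> r"
    have r: "0 \<le> r"
      using ab(1) norm_ge_zero order_trans by blast
    have pow: "norm (q ^ n) \<le> 1"
      using q_less_1 by (simp add: norm_power power_le_one)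
    have shrink: "norm (x * q ^ n) \<le> norm x" for x
      using mult_left_mono [OF pow, of "norm x"] by (simp add: norm_mult)
    have "norm (a * b * q ^ n / q) \<le> r * r / norm q"
      using order_trans [OF shrink [of "a * b"]] mult_mono [OF ab r norm_ge_zero]
      by (auto simp: norm_mult norm_divide intro!: divide_right_mono)
    moreover have "norm (- a * q ^ n) \<le> r" "norm (- b * q ^ n) \<le> r"
      using shrink [of "- a"] shrink [of "- b"] ab by auto
    ultimately have
      "norm (q_poch (a * b * q ^ n / q) q n) \<le> E (r * r / norm q)"
      "norm (q_poch_inf (- a * q ^ n) q) \<le> E r" "norm (q_poch_inf (- b * q ^ n) q) \<le> E r"
      unfolding E_def by - (rule norm_q_poch_le, rule q_less_1, assumption)+
    moreover have "0 \<le> E y" for y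
      by (simp add: E_def)
    ultimately have
      "norm q ^ n * (norm (q_poch (a * b * q ^ n / q) q n) * norm (inverse (q_poch q q n)) *
         (norm (q_poch_inf (- a * q ^ n) q) * norm (q_poch_inf (- b * q ^ n) q))) \<le> M n"
      unfolding M_def using C by (intro mult_mono mult_nonneg_nonneg order_refl) auto
    thus "norm (T n a b) \<le> M n"
      by (simp add: T_def norm_mult norm_divide norm_power norm_inverse divide_inverse mult_ac)
  qed
qed

lemma summable_T: "summable (\<lambda>n. T n a b)"
proof -
  define r where "r = max (norm a) (norm b)"
  obtain M where "summable M" "\<forall>n a b. norm a \<le> r \<longrightarrow> norm b \<le> r \<longrightarrow> norm (T n a b) \<le> M n"
    using T_bound by blast
  thus ?thesis
    by (auto intro: summable_comparison_test' simp: r_def)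
qed

lemma T_sums: "(\<lambda>n. T n a b) sums R a b"
  unfolding R_def by (rule summable_sums [OF summable_T])

lemma power_tendsto_0: "(\<lambda>N. a * q ^ N) \<longlonglongrightarrow> 0"
  using tendsto_mult_right_zero [OF LIMSEQ_power_zero [OF q_less_1]] .

text \<open>Tannery's theorem with the majorant of \<open>T_bound\<close>, as the points
  \<open>a * q ^ N\<close> stay in one disc. Continuity of \<open>R\<close> at 0 is used only along
  such sequences.\<close>

lemma R_tendsto: "(\<lambda>N. R (a * q ^ N) b) \<longlonglongrightarrow> R 0 b"
proof -
  define r where "r = max (norm a) (norm b)"
  obtain M where M: "summable M" "\<forall>n a b. norm a \<le> r \<longrightarrow> norm b \<le> r \<longrightarrow> norm (T n a b) \<le> M n"
    using T_bound by blast
  have "norm (a * q ^ N) \<le> r" for N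
  proof -
    have "norm a * norm q ^ N \<le> norm a * 1"
      using q_less_1 by (intro mult_left_mono power_le_one) auto
    thus ?thesis
      by (simp add: r_def norm_mult norm_power)
  qed
  hence "norm (T n (a * q ^ N) b) \<le> M n" for n N
    using M(2) by (simp add: r_def)
  moreover have "(\<lambda>N. T n (a * q ^ N) b) \<longlonglongrightarrow> T n 0 b" for n
  proof -
    have shift: "(\<lambda>N. c * (a * q ^ N) * d) \<longlonglongrightarrow> 0" for c d
      using tendsto_mult_left_zero [OF tendsto_mult_right_zero [OF power_tendsto_0]] .
    have "(\<lambda>N. a * q ^ N * b * q ^ n / q) \<longlonglongrightarrow> 0"
      using shift [of 1 "b * q ^ n / q"] by (simp add: mult_ac)
    moreover have "(\<lambda>N. q_poch_inf (- (a * q ^ N) * q ^ n) q) \<longlonglongrightarrow> 1"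
      using shift [of "- 1" "q ^ n"] by (intro tendsto_q_poch_inf_0 q_less_1) simp
    moreover have "q_poch_inf 0 q = 1"
      by (simp add: q_poch_inf_def)
    ultimately show ?thesis
      unfolding T_def by (auto intro!: tendsto_eq_intros simp: q_poch_q_nonzero q_less_1)
  qed
  ultimately show ?thesis
    using tannerys_theorem [of "\<lambda>n N. T n (a * q ^ N) b" "\<lambda>n. T n 0 b" sequentially M] M(1)
    by (simp add: R_def case_prod_unfold)
qed

section \<open>The contiguous relation and the first-order recurrence\<close>

lemma T_0_shift: "T 0 a b = (1 + a) * T 0 (a * q) b"
  using q_poch_inf_step_q [of "- a"] by (simp add: T_def)

text \<open>With w = q^n, dividing by a common factor leaves the polynomial identity (1 - abw)(1 +
  aqw) = (1 + a)(1 - abqw^2) - a(1 - qw)(1 + bw). The index drops to \<open>n\<close> in the last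
  summand, which is why \<open>T_0_shift\<close> has only two terms.\<close>

lemma T_Suc_shift:
  "T (Suc n) a b = (1 + a) * T (Suc n) (a * q) b - a * q * T n (a * q\<^sup>2) b"
proof -
  define w where "w = q ^ n"
  define X where "X = q_poch (a * b * q * w) q n"
  define J where "J = q_poch_inf (- a * q\<^sup>2 * w) q"
  define B where "B = q_poch_inf (- b * q * w) q"
  define c where "c = q_poch q q n"
  have c: "c \<noteq> 0" "q_poch q q (Suc n) = c * (1 - q * w)" "1 - q * w \<noteq> 0"
    using q_poch_q_nonzero(1) [of n] power_neq_1 [of n]
    by (auto simp: c_def q_poch_Suc w_def)
  have J: "q_poch_inf (- a * q * w) q = (1 + a * q * w) * J"
    using q_poch_inf_step_q [of "- a * q * w"] by (simp add: J_def power2_eq_square mult_ac)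
  have B: "q_poch_inf (- b * w) q = (1 + b * w) * B"
    using q_poch_inf_step_q [of "- b * w"] by (simp add: B_def mult_ac)
  have X0: "q_poch (a * b * w) q (Suc n) = (1 - a * b * w) * X"
    by (simp add: q_poch_Suc' X_def mult_ac)
  have X1: "q_poch (a * b * q * w) q (Suc n) = X * (1 - a * b * q * w\<^sup>2)"
    by (simp add: q_poch_Suc X_def w_def power2_eq_square mult_ac)
  \<comment> \<open>\<open>K\<close> collects what the three summands share: the \<open>n\<close>
    common factors \<open>X\<close> and the tails \<open>J\<close>, \<open>B\<close> of the infinite
    products.\<close>
  define K where "K = q * w * X * J * B / (c * (1 - q * w))"
  have T0: "T (Suc n) a b = K * ((1 - a * b * w) * (1 + a * q * w))"
    using X0 J c by (simp add: T_def K_def B_def mult_ac flip: w_def)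
  have T1: "T (Suc n) (a * q) b = K * (1 - a * b * q * w\<^sup>2)"
    using X1 c by (simp add: T_def K_def B_def J_def power2_eq_square mult_ac flip: w_def)
  have T2: "q * T n (a * q\<^sup>2) b = K * ((1 - q * w) * (1 + b * w))"
    using B c by (simp add: T_def K_def X_def J_def c_def power2_eq_square mult_ac flip: w_def)
  show ?thesis
    using T0 T1 T2 by algebra
qed

lemma T_Suc_sums: "(\<lambda>n. T (Suc n) a b) sums (R a b - T 0 a b)"
  by (subst sums_Suc_iff [of "\<lambda>n. T n a b"]) (simp add: T_sums)

text \<open>Summing the contiguous relation over all indices gives R(a) = (1 + a) R(aq) - aq
  R(aq^2), with \<open>b\<close> fixed. It is arranged so that both sides are the same expression,
  at \<open>a\<close> and at \<open>a * q\<close>.\<close>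

lemma R_shift: "R a b - a * R (a * q) b = R (a * q) b - a * q * R (a * q\<^sup>2) b"
proof -
  have "(\<lambda>n. (1 + a) * T (Suc n) (a * q) b - a * q * T n (a * q\<^sup>2) b) sums
      ((1 + a) * (R (a * q) b - T 0 (a * q) b) - a * q * R (a * q\<^sup>2) b)"
    by (rule sums_diff [OF sums_mult [OF T_Suc_sums] sums_mult [OF T_sums]])
  hence "(\<lambda>n. T (Suc n) a b) sums
      ((1 + a) * (R (a * q) b - T 0 (a * q) b) - a * q * R (a * q\<^sup>2) b)"
    by (simp only: T_Suc_shift [of _ a b, symmetric])
  with T_Suc_sums [of a b] have "R a b - T 0 a b =
      (1 + a) * (R (a * q) b - T 0 (a * q) b) - a * q * R (a * q\<^sup>2) b"
    by (rule sums_unique2)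
  thus ?thesis
    using T_0_shift [of a b] by (simp add: algebra_simps)
qed

text \<open>The difference \<open>D\<close> is constant along \<open>a * q ^ N\<close>, hence equals
  its limit, which is \<open>R 0 b\<close>.\<close>

lemma R_step: "R a b = a * R (a * q) b + R 0 b"
proof -
  define D where "D = (\<lambda>a. R a b - a * R (a * q) b)"
  have D: "D (a * q ^ N) = D a" for N
  proof (induction N)
    case (Suc N)
    show ?case
      using R_shift [of "a * q ^ N" b] Suc by (simp add: D_def power2_eq_square mult_ac)
  qed simp
  have "(\<lambda>N. R (a * q ^ N) b - (a * q ^ N) * R (a * q * q ^ N) b) \<longlonglongrightarrow> R 0 b - 0 * R 0 b"
    by (intro tendsto_intros R_tendsto power_tendsto_0)
  hence "(\<lambda>N. D (a * q ^ N)) \<longlonglongrightarrow> R 0 b"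
    by (simp add: D_def mult_ac)
  hence "D a = R 0 b"
    unfolding D by (simp add: LIMSEQ_const_iff)
  thus ?thesis
    by (simp add: D_def algebra_simps)
qed

section \<open>Uniqueness for the recurrence and the product formula\<close>

text \<open>In the closed unit disc the equation makes the norm nondecreasing along z, zq, zq^2,
  ..., while the limit is 0. From any other \<open>z\<close> this orbit enters the disc, and the
  equation carries the zero back step by step.\<close>

lemma functional_equation_zero:
  fixes h :: "complex \<Rightarrow> complex"
  assumes step: "\<And>z. h z = z * h (z * q)" and lim: "\<And>z. (\<lambda>N. h (z * q ^ N)) \<longlonglongrightarrow> 0"
  shows "h z = 0"
proof -
  have small: "h z = 0" if "norm z \<le> 1" for z
  proof -
    have le: "norm (z * q ^ N) \<le> 1" for N
      using that q_less_1 by (auto simp: norm_mult norm_power intro!: mult_le_one power_le_one)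
    have "norm (h z) \<le> norm (h (z * q ^ N))" for N
    proof (induction N)
      case (Suc N)
      have "norm (h (z * q ^ N)) = norm (z * q ^ N) * norm (h (z * q ^ Suc N))"
        by (subst step) (simp add: norm_mult mult_ac)
      also have "\<dots> \<le> norm (h (z * q ^ Suc N))"
        using le by (intro mult_left_le_one_le) auto
      finally show ?case
        using Suc by simp
    qed simp
    hence "norm (h z) \<le> 0"
      using tendsto_norm_zero [OF lim [of z]] by (intro LIMSEQ_le_const) auto
    thus ?thesis
      by simp
  qed
  have "eventually (\<lambda>N. norm (z * q ^ N) < 1) sequentially"
    using order_tendstoD(2) [OF tendsto_norm_zero [OF power_tendsto_0 [of z]]] by simp
  then obtain N where "norm (z * q ^ N) < 1"
    by (auto simp: eventually_sequentially)
  hence "h (z * q ^ N) = 0"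
    by (intro small) simp
  thus ?thesis
  proof (induction N)
    case (Suc N)
    thus ?case
      using step [of "z * q ^ N"] by (simp add: mult_ac)
  qed simp
qed

text \<open>The sum of q^n / (q;q)_n telescopes: its partial sum up to N is 1 / (q;q)_N.\<close>

lemma R_0_0: "R 0 0 * q_poch_inf q q = 1"
proof -
  have "(\<Sum>n<Suc N. T n 0 0) = inverse (q_poch q q N)" for N
  proof (induction N)
    case 0
    show ?case
      by (simp add: T_def q_poch_inf_def)
  next
    case (Suc N)
    have "1 - q * q ^ N \<noteq> 0"
      using power_neq_1 [of N] by simp
    thus ?case
      using Suc q_poch_q_nonzero(1) [of N]
      by (simp add: T_def q_poch_inf_def q_poch_Suc divide_simps)
  qed
  moreover have "(\<lambda>N. inverse (q_poch q q N)) \<longlonglongrightarrow> inverse (q_poch_inf q q)"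
    by (intro tendsto_intros q_poch_LIMSEQ q_less_1 q_poch_inf_q_nonzero)
  moreover have "(\<lambda>N. \<Sum>n<Suc N. T n 0 0) \<longlonglongrightarrow> R 0 0"
    using T_sums [of 0 0] unfolding sums_def by (rule LIMSEQ_Suc)
  ultimately have "R 0 0 = inverse (q_poch_inf q q)"
    by (simp add: LIMSEQ_unique)
  thus ?thesis
    using q_poch_inf_q_nonzero by simp
qed

text \<open>As functions of \<open>a\<close>, both sides satisfy the same recurrence with the same
  inhomogeneous term, by \<open>R_0_0\<close>. Their difference solves the homogeneous equation and
  tends to 0.\<close>

lemma R_product: "R a b = q_poch_inf q q * R a 0 * R b 0"
proof -
  define h where "h = (\<lambda>a. R a b - q_poch_inf q q * R a 0 * R b 0)"
  have "h a = 0"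
  proof (rule functional_equation_zero [of h])
    show "h z = z * h (z * q)" for z
      unfolding h_def
      using R_step [of z b] R_step [of z 0] R_0_0 R_commute [of 0 b] by algebra
    show "(\<lambda>N. h (z * q ^ N)) \<longlonglongrightarrow> 0" for z
    proof -
      have "(\<lambda>N. h (z * q ^ N)) \<longlonglongrightarrow> R 0 b - q_poch_inf q q * R 0 0 * R b 0"
        unfolding h_def by (intro tendsto_intros R_tendsto)
      moreover have "R 0 b - q_poch_inf q q * R 0 0 * R b 0 = 0"
        using R_0_0 R_commute [of 0 b] by algebra
      ultimately show ?thesis
        by simp
    qed
  qed
  thus ?thesis
    by (simp add: h_def)
qed

section \<open>Both sides of the identity in terms of \<open>R\<close>\<close>

text \<open>
  The terms of both sides with the removable factors \<open>(a;q)\<^sub>n\<close> and \<open>(a b/q;q)\<^sub>n\<close> cancelled.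
\<close>

definition phi_term :: "complex \<Rightarrow> nat \<Rightarrow> complex" where
  "phi_term a n = (if n = 0 then 1 else (1 - a / q) * q_poch (a * q ^ n) q (n - 1)) /
     (q_poch (q\<^sup>2) (q\<^sup>2) n * q_poch (- a) q n) * (q\<^sup>2) ^ n"

definition psi_term :: "complex \<Rightarrow> complex \<Rightarrow> nat \<Rightarrow> complex" where
  "psi_term a b n = q_poch (a * b * q ^ n / q) q n /
     (q_poch q q n * (q_poch (- a) q n * q_poch (- b) q n)) * q ^ n"

lemma psi_term_eq:
  assumes "\<And>n. q_poch (- a) q n \<noteq> 0" "\<And>n. q_poch (- b) q n \<noteq> 0"
  shows "psi_term a b n = T n a b / (q_poch_inf (- a) q * q_poch_inf (- b) q)"
proof -
  have "q_poch_inf (- a) q \<noteq> 0" "q_poch_inf (- b) q \<noteq> 0"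
    using assms by (intro q_poch_inf_nonzero q_less_1; simp)+
  thus ?thesis
    using q_poch_inf_split [OF q_less_1, of "- a" n] q_poch_inf_split [OF q_less_1, of "- b" n]
    by (simp add: psi_term_def T_def field_simps)
qed

text \<open>The values 1 and \<open>q\<close> of the second parameter are neighbours, so their
  infinite products differ only by the factor 1 + q^n. The difference of the numerators contributes
  a second q^n, which turns q^n into the (q^2)^n of the series.\<close>

lemma phi_term_eq:
  assumes "\<And>n. q_poch (- a) q n \<noteq> 0"
  shows "phi_term a n = (T n a 1 - T n a q) / (q_poch_inf (- a) q * q_poch_inf (- q) q)"
proof -
  define w where "w = q ^ n"
  define J where "J = q_poch_inf (- a * w) q"
  define B where "B = q_poch_inf (- q * w) q"
  have nz: "q_poch_inf (- a) q \<noteq> 0" "q_poch_inf (- q) q \<noteq> 0"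
    using assms by (intro q_poch_inf_nonzero q_less_1 q_poch_q_nonzero; simp)+
  have "q_poch_inf (- 1 * w) q = (1 + w) * B"
    using q_poch_inf_step_q [of "- 1 * w"] by (simp add: B_def mult_ac)
  hence T: "T n a 1 - T n a q = w * J * B / q_poch q q n *
      ((1 + w) * q_poch (a * w / q) q n - q_poch (a * w) q n)"
    by (simp add: T_def J_def B_def right_diff_distrib diff_divide_distrib mult_ac flip: w_def)
  \<comment> \<open>For n \<ge> 1, after removing the common n - 1 factors, this is (1 + w)(1 - av)
    - (1 - awv) = w - av with v = q^(n-1).\<close>
  have numerator: "(1 + w) * q_poch (a * w / q) q n - q_poch (a * w) q n =
      w * (if n = 0 then 1 else (1 - a / q) * q_poch (a * q ^ n) q (n - 1))"
  proof (cases n)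
    case 0
    thus ?thesis by (simp add: w_def)
  next
    case (Suc k)
    define v where "v = q ^ k"
    have w: "w = q * v"
      by (simp add: w_def v_def Suc)
    have "q_poch (a * w / q) q n = (1 - a * v) * q_poch (a * w) q k"
      by (simp add: Suc q_poch_Suc' w mult_ac)
    moreover have "q_poch (a * w) q n = q_poch (a * w) q k * (1 - a * w * v)"
      by (simp add: Suc q_poch_Suc v_def)
    moreover have "a * v = w * (a / q)"
      by (simp add: w)
    ultimately have "(1 + w) * q_poch (a * w / q) q n - q_poch (a * w) q n =
        w * ((1 - a / q) * q_poch (a * w) q k)"
      by algebra
    thus ?thesis
      by (simp add: Suc w_def)
  qed
  have "q_poch (q\<^sup>2) (q\<^sup>2) n = q_poch q q n * q_poch (- q) q n"
    by (simp add: q_poch_mult_minus)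
  moreover have "q_poch_inf (- a) q = q_poch (- a) q n * J"
    "q_poch_inf (- q) q = q_poch (- q) q n * B"
    using q_poch_inf_split [OF q_less_1, of "- a" n] q_poch_inf_split [OF q_less_1, of "- q" n]
    by (simp_all add: J_def B_def w_def)
  moreover have "(q\<^sup>2) ^ n = w * w"
    by (simp add: w_def power2_eq_square power_mult_distrib)
  ultimately show ?thesis
    unfolding phi_term_def T numerator using nz by (simp add: mult_ac)
qed

lemma product_identity:
  assumes "\<And>n. q_poch (- a) q n \<noteq> 0" "\<And>n. q_poch (- b) q n \<noteq> 0"
  shows "(\<Sum>n. phi_term a n) * (\<Sum>n. phi_term b n) =
    q_poch_inf q (q\<^sup>2) / q_poch_inf (q\<^sup>2) (q\<^sup>2) * (\<Sum>n. psi_term a b n)"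
proof -
  have phi: "(\<Sum>n. phi_term c n) = R c 0 / (q_poch_inf (- c) q * q_poch_inf (- q) q)"
    if "\<And>n. q_poch (- c) q n \<noteq> 0" for c
  proof -
    have "(\<lambda>n. phi_term c n) sums ((R c 1 - R c q) / (q_poch_inf (- c) q * q_poch_inf (- q) q))"
      unfolding phi_term_eq [OF that] by (rule sums_divide [OF sums_diff [OF T_sums T_sums]])
    \<comment> \<open>By the product formula the difference is (q;q)_inf R(c,0) (R(1,0) - R(q,0)),
      and the recurrence at 1 reduces the bracket to R(0,0) = 1 / (q;q)_inf.\<close>
    moreover have "R c 1 - R c q = R c 0"
      using R_product [of c 1] R_product [of c q] R_step [of 1 0] R_0_0 by simp algebra
    ultimately show ?thesis
      by (simp add: sums_iff)
  qed
  have "(\<lambda>n. psi_term a b n) sums (R a b / (q_poch_inf (- a) q * q_poch_inf (- b) q))"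
    unfolding psi_term_eq [OF assms] by (rule sums_divide [OF T_sums])
  hence psi: "(\<Sum>n. psi_term a b n) =
      q_poch_inf q q * R a 0 * R b 0 / (q_poch_inf (- a) q * q_poch_inf (- b) q)"
    by (simp add: sums_iff R_product [of a b])
  have eqs: "q_poch_inf q q * q_poch_inf (- q) q = q_poch_inf (q\<^sup>2) (q\<^sup>2)"
    "q_poch_inf q q = q_poch_inf q (q\<^sup>2) * q_poch_inf (q\<^sup>2) (q\<^sup>2)"
    using q_poch_inf_mult_minus [OF q_less_1, of q] q_poch_inf_double [OF q_less_1, of q]
    by (simp_all add: power2_eq_square)
  have nz: "q_poch_inf (- a) q \<noteq> 0" "q_poch_inf (- b) q \<noteq> 0" "q_poch_inf q q \<noteq> 0"
    "q_poch_inf (- q) q \<noteq> 0"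
    by (intro q_poch_inf_nonzero [OF q_less_1] assms q_poch_q_nonzero)+
  \<comment> \<open>Combining the two factorizations yields Euler's identity (q;q^2)_inf (-q;q)_inf
    = 1.\<close>
  have "q_poch_inf (q\<^sup>2) (q\<^sup>2) * (q_poch_inf q (q\<^sup>2) * q_poch_inf (- q) q) = q_poch_inf (q\<^sup>2) (q\<^sup>2)"
    using eqs by (metis mult.assoc mult.commute)
  moreover have "q_poch_inf (q\<^sup>2) (q\<^sup>2) \<noteq> 0"
    using nz by (simp flip: eqs(1))
  ultimately have "q_poch_inf q (q\<^sup>2) * q_poch_inf (- q) q = 1"
    by simp
  hence "q_poch_inf q (q\<^sup>2) = 1 / q_poch_inf (- q) q"
    using nz by (simp add: eq_divide_eq)
  hence factor: "q_poch_inf q (q\<^sup>2) / q_poch_inf (q\<^sup>2) (q\<^sup>2) * q_poch_inf q q =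
      1 / (q_poch_inf (- q) q * q_poch_inf (- q) q)"
    using nz by (simp flip: eqs(1))
  have "q_poch_inf q (q\<^sup>2) / q_poch_inf (q\<^sup>2) (q\<^sup>2) * (\<Sum>n. psi_term a b n) =
      (q_poch_inf q (q\<^sup>2) / q_poch_inf (q\<^sup>2) (q\<^sup>2) * q_poch_inf q q) *
      (R a 0 * R b 0 / (q_poch_inf (- a) q * q_poch_inf (- b) q))"
    unfolding psi by (simp add: mult_ac)
  thus ?thesis
    unfolding phi [OF assms(1)] phi [OF assms(2)] factor by (simp add: mult_ac)
qed

section \<open>Cancellation in the hypergeometric terms at regular parameters\<close>

text \<open>The numerator is (a/q;q)_(2n) and the denominator contains (a;q)_n (-a;q)_n. Regularity
  allows (a;q)_n to be cancelled.\<close>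

lemma bhs_term_phi:
  assumes "bhs_regular [a\<^sup>2] (q\<^sup>2)"
  shows "bhs_term [a, a / q] [a\<^sup>2] (q\<^sup>2) (q\<^sup>2) n = phi_term a n"
proof -
  have split: "q_poch (a\<^sup>2) (q\<^sup>2) n = q_poch a q n * q_poch (- a) q n"
    by (simp add: q_poch_mult_minus)
  have nz: "q_poch a q n \<noteq> 0"
    using assms split unfolding bhs_regular_def by (metis list.set_intros(1) mult_zero_left)
  have "q_poch a (q\<^sup>2) n * q_poch (a / q) (q\<^sup>2) n = q_poch (a / q) q (2 * n)"
    by (simp add: q_poch_double)
  also have "\<dots> = (if n = 0 then 1 else (1 - a / q) * q_poch (a * q ^ n) q (n - 1)) *
      q_poch a q n"
  proof (cases n)
    case (Suc k)
    \<comment> \<open>The 2n factors are split as 1 + n + (n - 1); the middle block is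
      (a;q)_n.\<close>
    have "2 * n = Suc (n + k)"
      using Suc by simp
    thus ?thesis
      using Suc by (simp only: q_poch_Suc' q_poch_add) (simp add: mult_ac)
  qed simp
  finally show ?thesis
    using nz by (simp add: bhs_term_def phi_term_def split)
qed

text \<open>Opposite signs pair up, so only the squares of \<open>u\<close> and \<open>v\<close>
  matter: the numerator is (ab;q^2)_n (ab/q;q^2)_n = (ab/q;q)_(2n), whose first half
  cancels.\<close>

lemma bhs_term_psi:
  assumes "bhs_regular [- a, - b, a * b / q] q" "u\<^sup>2 = a * b" "v\<^sup>2 = a * b / q"
  shows "bhs_term [u, - u, v, - v] [- a, - b, a * b / q] q q n = psi_term a b n"
proof -
  have nz: "q_poch (a * b / q) q n \<noteq> 0"
    using assms(1) by (auto simp: bhs_regular_def)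
  have "q_poch u q n * (q_poch (- u) q n * (q_poch v q n * q_poch (- v) q n)) =
      q_poch (u\<^sup>2) (q\<^sup>2) n * q_poch (v\<^sup>2) (q\<^sup>2) n"
    by (simp add: mult.assoc flip: q_poch_mult_minus)
  also have "\<dots> = q_poch (a * b / q) q (2 * n)"
    by (simp add: assms(2,3) q_poch_double)
  also have "\<dots> = q_poch (a * b / q) q n * q_poch (a * b * q ^ n / q) q n"
    by (simp add: mult_2 q_poch_add)
  finally show ?thesis
    using nz by (simp add: bhs_term_def psi_term_def)
qed

section \<open>Limits through regular parameters\<close>

lemma countable_q_poch_zeros: "countable {x. \<exists>n. q_poch x q n = 0}"
proof (rule countable_subset)
  show "{x. \<exists>n. q_poch x q n = 0} \<subseteq> range (\<lambda>i. inverse (q ^ i))"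
    by (auto simp: q_poch_eq_0_iff inverse_unique image_iff mult.commute) (metis inverse_unique mult.commute)
qed simp

lemma bhs_regular_square_iff:
  "bhs_regular [a\<^sup>2] (q\<^sup>2) \<longleftrightarrow> (\<forall>n. q_poch a q n \<noteq> 0) \<and> (\<forall>n. q_poch (- a) q n \<noteq> 0)"
  by (auto simp: bhs_regular_def simp flip: q_poch_mult_minus)

lemma islimpt_phi: "a islimpt {a'. bhs_regular [a'\<^sup>2] (q\<^sup>2)}"
proof -
  let ?Z = "{x. \<exists>n. q_poch x q n = 0}"
  have "countable (?Z \<union> uminus ` ?Z)"
    using countable_q_poch_zeros by simp
  hence "a islimpt - (?Z \<union> uminus ` ?Z)"
    by (rule islimpt_countable_complement)
  moreover have "- (?Z \<union> uminus ` ?Z) \<subseteq> {a'. bhs_regular [a'\<^sup>2] (q\<^sup>2)}"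
    by (force simp: bhs_regular_square_iff image_iff)
  ultimately show ?thesis
    by (rule islimpt_subset)
qed

text \<open>It suffices to move the first coordinate and keep \<open>b\<close>, which avoids
  countably many values. For \<open>b = 0\<close> the third lower parameter is 0 and never
  singular.\<close>

lemma islimpt_psi:
  assumes "\<And>n. q_poch (- b) q n \<noteq> 0"
  shows "(a, b) islimpt {(a', b'). bhs_regular [- a', - b', a' * b' / q] q}"
proof -
  let ?Z = "{x. \<exists>n. q_poch x q n = 0}"
  let ?C = "uminus ` ?Z \<union> (\<lambda>x. x * q / b) ` ?Z"
  have reg: "bhs_regular [- a', - b, a' * b / q] q" if "a' \<notin> ?C" for a'
  proof -
    have "q_poch (a' * b / q) q n \<noteq> 0" for n
    proof (cases "b = 0")
      case False
      hence "a' = (a' * b / q) * q / b"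
        by simp
      thus ?thesis
        using that by blast
    qed simp
    moreover have "q_poch (- a') q n \<noteq> 0" for n
      using that by (force simp: image_iff)
    ultimately show ?thesis
      using assms by (simp add: bhs_regular_def)
  qed
  have "countable ?C"
    using countable_q_poch_zeros by simp
  hence lim: "a islimpt (- ?C)"
    by (rule islimpt_countable_complement)
  show ?thesis
    unfolding islimpt_approachable
  proof (intro allI impI)
    fix e :: real assume "e > 0"
    then obtain a' where "a' \<notin> ?C" "a' \<noteq> a" "dist a' a < e"
      using lim unfolding islimpt_approachable by blast
    thus "\<exists>x'\<in>{(a', b'). bhs_regular [- a', - b', a' * b' / q] q}. x' \<noteq> (a, b) \<and> dist x' (a, b) < e"
      using reg by (intro bexI [of _ "(a', b)"]) (auto simp: dist_Pair_Pair)
  qed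
qed

text \<open>At regular points the terms are those of \<open>phi_term\<close>, which is continuous at
  \<open>a\<close> because its denominator contains only (-a;q)_n and (q^2;q^2)_n.\<close>

lemma bhs_ext_phi:
  assumes "\<And>n. q_poch (- a) q n \<noteq> 0"
  shows "bhs_ext (\<lambda>a. [a, a / q]) (\<lambda>a. [a\<^sup>2]) (q\<^sup>2) (q\<^sup>2) a = (\<Sum>n. phi_term a n)"
  unfolding bhs_ext_def
proof (intro suminf_cong tendsto_Lim)
  let ?S = "{a'. bhs_regular [a'\<^sup>2] (q\<^sup>2)}"
  show "\<not> trivial_limit (at a within ?S)"
    using islimpt_phi by (simp add: trivial_limit_within)
  fix n
  have "q_poch (q\<^sup>2) (q\<^sup>2) n \<noteq> 0"
    using q_poch_q_nonzero [of n] by (simp flip: q_poch_mult_minus)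
  hence "((\<lambda>a'. phi_term a' n) \<longlongrightarrow> phi_term a n) (at a within ?S)"
    unfolding phi_term_def using assms by (cases n) (auto intro!: tendsto_intros)
  thus "((\<lambda>a'. bhs_term [a', a' / q] [a'\<^sup>2] (q\<^sup>2) (q\<^sup>2) n) \<longlongrightarrow> phi_term a n) (at a within ?S)"
    by (rule Lim_transform_within [OF _ zero_less_one]) (simp add: bhs_term_phi)
qed

text \<open>The square roots may be discontinuous, but the regular terms depend only on their
  squares and agree with \<open>psi_term\<close>, which is continuous at the pair.\<close>

lemma bhs_ext_psi:
  assumes "\<And>n. q_poch (- a) q n \<noteq> 0" "\<And>n. q_poch (- b) q n \<noteq> 0"
    and "\<And>z. (s z)\<^sup>2 = z" "\<And>z. (t z)\<^sup>2 = z"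
  shows "bhs_ext (\<lambda>(a, b). [s (a * b), - s (a * b), t (a * b / q), - t (a * b / q)])
      (\<lambda>(a, b). [- a, - b, a * b / q]) q q (a, b) = (\<Sum>n. psi_term a b n)"
  unfolding bhs_ext_def
proof (intro suminf_cong tendsto_Lim)
  let ?S = "{c'. bhs_regular (case c' of (a, b) \<Rightarrow> [- a, - b, a * b / q]) q}"
  have "?S = {(a', b'). bhs_regular [- a', - b', a' * b' / q] q}"
    by auto
  thus "\<not> trivial_limit (at (a, b) within ?S)"
    using islimpt_psi [OF assms(2)] by (simp add: trivial_limit_within)
  fix n
  have fst: "(fst \<longlongrightarrow> a) (at (a, b) within ?S)" and snd: "(snd \<longlongrightarrow> b) (at (a, b) within ?S)"
    by (auto intro!: tendsto_eq_intros)
  have "((\<lambda>c. psi_term (fst c) (snd c) n) \<longlongrightarrow> psi_term a b n) (at (a, b) within ?S)"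
    unfolding psi_term_def using assms q_poch_q_nonzero
    by (intro tendsto_intros fst snd) auto
  thus "((\<lambda>c. bhs_term
        (case c of (a, b) \<Rightarrow> [s (a * b), - s (a * b), t (a * b / q), - t (a * b / q)])
        (case c of (a, b) \<Rightarrow> [- a, - b, a * b / q]) q q n) \<longlongrightarrow> psi_term a b n)
      (at (a, b) within ?S)"
    by (rule Lim_transform_within [OF _ zero_less_one])
      (auto simp: assms bhs_term_psi split: prod.splits)
qed

end

section \<open>The identity at regular parameters and its extension\<close>

theorem theorem1p5:
  fixes q a b :: complex and s t :: "complex \<Rightarrow> complex"
  assumes q: "0 < norm q" "norm q < 1"
    and a: "\<And>m::nat. a \<noteq> - (q powi (- int m))"
    and b: "\<And>m::nat. b \<noteq> - (q powi (- int m))"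
    and s: "\<And>z. (s z)\<^sup>2 = z"
    and t: "\<And>z. (t z)\<^sup>2 = z"
  shows
    "(bhs_regular [a\<^sup>2] (q\<^sup>2) \<and> bhs_regular [b\<^sup>2] (q\<^sup>2) \<and> bhs_regular [- a, - b, a * b / q] q \<longrightarrow>
        bhs [a, a / q] [a\<^sup>2] (q\<^sup>2) (q\<^sup>2) * bhs [b, b / q] [b\<^sup>2] (q\<^sup>2) (q\<^sup>2) =
        q_poch_inf q (q\<^sup>2) / q_poch_inf (q\<^sup>2) (q\<^sup>2) *
        bhs [s (a * b), - s (a * b), t (a * b / q), - t (a * b / q)] [- a, - b, a * b / q] q q)
     \<and>
     bhs_ext (\<lambda>a. [a, a / q]) (\<lambda>a. [a\<^sup>2]) (q\<^sup>2) (q\<^sup>2) a *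
     bhs_ext (\<lambda>b. [b, b / q]) (\<lambda>b. [b\<^sup>2]) (q\<^sup>2) (q\<^sup>2) b =
     q_poch_inf q (q\<^sup>2) / q_poch_inf (q\<^sup>2) (q\<^sup>2) *
     bhs_ext (\<lambda>(a, b). [s (a * b), - s (a * b), t (a * b / q), - t (a * b / q)])
             (\<lambda>(a, b). [- a, - b, a * b / q]) q q (a, b)"
proof -
  interpret nome q
    by unfold_locales (fact q)+
  \<comment> \<open>The excluded values -q^(-m) are exactly those at which some (-c;q)_n
    vanishes.\<close>
  have nz: "q_poch (- c) q n \<noteq> 0" if c: "\<And>m::nat. c \<noteq> - (q powi (- int m))" for c n
  proof
    assume "q_poch (- c) q n = 0"
    then obtain i where "- c * q ^ i = 1"
      by (auto simp: q_poch_eq_0_iff)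
    hence "c = - (q powi (- int i))"
      by (simp add: power_int_minus field_simps minus_equation_iff [of "c * _"])
    thus False
      using c by blast
  qed
  \<comment> \<open>Both conjuncts reduce to \<open>product_identity\<close>: the first because
    regular terms equal the cancelled ones, the second because the limits do.\<close>
  show ?thesis
    unfolding bhs_ext_phi [OF nz [OF a]] bhs_ext_phi [OF nz [OF b]]
      bhs_ext_psi [OF nz [OF a] nz [OF b] s t]
    using product_identity [OF nz [OF a] nz [OF b]]
    by (simp add: bhs_def bhs_term_phi bhs_term_psi s t)
qed

end
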